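(* For $\alpha>0$ let $f_\alpha$ be the density of the free Gamma distribution $\nu_\alpha$. For any $x$ in $(0,\infty)$ we have \[ \tfrac1\alpha f_\alpha(x)\to x^{-1}e^{-x},\quad\text{as }\alpha\to0 . \]
   Context: For $\alpha>0$ the free Gamma distribution $\nu_\alpha=\Lambda(\mu_\alpha)$ is the image under the Bercovici–Pata bijection $\Lambda$ of the classical Gamma distribution $\mu_\alpha(dt)=\frac1{\Gamma(\alpha)}t^{\alpha-1}e^{-t}1_{[0,\infty)}(t)\,dt$. ($\Lambda$ sends the $*$-infinitely divisible law with Lévy–Khintchine triplet $(a,\rho,\eta)$ to the law, infinitely divisible for free additive convolution, whose free cumulant transform $\mathcal{C}(z)=zG^{\langle-1\rangle}(z)-1$, with $G$ the Cauchy transform, equals $\eta z+az^2+\int_{\mathbb{R}}(\frac1{1-tz}-1-tz1_{[-1,1]}(t))\,\rho(dt)$.) The measure $\nu_\alpha$ is absolutely continuous, and its density $f_\alpha$ is the following function. For $z\in\mathbb{C}\setminus[0,\infty)$ put $H_\alpha(z)=z+\alpha+\alpha\int_0^\infty\frac{te^{-t}}{z-t}\,dt$ and $F(z)=\int_0^\infty\frac{te^{-t}}{|z-t|^2}\,dt$. $c_\alpha$ is the unique positive number with $F(-c_\alpha)=\frac1\alpha$. $v_\alpha\colon\mathbb{R}\to[0,\infty)$ is given by $v_\alpha(x)=0$ for $x\le-c_\alpha$, and for $x>-c_\alpha$, $v_\alpha(x)$ is the unique $y>0$ with $F(x+\mathrm{i}y)=\frac1\alpha$. Then $H_\alpha(x+\mathrm{i}v_\alpha(x))\in\mathbb{R}$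 for all $x\in\mathbb{R}$, and $P_\alpha(x)=H_\alpha(x+\mathrm{i}v_\alpha(x))$ defines a strictly increasing bijection $P_\alpha\colon\mathbb{R}\to\mathbb{R}$ with inverse $P_\alpha^{\langle-1\rangle}$. Put $s_\alpha=P_\alpha(-c_\alpha)$ and $Q_\alpha(x)=\frac{v_\alpha(x)}{x^2+v_\alpha(x)^2}$. Then $f_\alpha(\xi)=0$ for $\xi\le s_\alpha$ and $f_\alpha(\xi)=\frac1\pi Q_\alpha(P_\alpha^{\langle-1\rangle}(\xi))$ for $\xi>s_\alpha$. *)

theory Defs
  imports "HOL-Analysis.Analysis"
begin

definition free_gamma_H :: "real \<Rightarrow> complex \<Rightarrow> complex" where
  "free_gamma_H \<alpha> z = z + of_real \<alpha> + of_real \<alpha> *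
     (LBINT t:{0..}. of_real (t * exp (- t)) / (z - of_real t))"

definition free_gamma_F :: "complex \<Rightarrow> real" where
  "free_gamma_F z = (LBINT t:{0..}. t * exp (- t) / (cmod (z - of_real t))\<^sup>2)"

definition free_gamma_c :: "real \<Rightarrow> real" where
  "free_gamma_c \<alpha> = (THE c. c > 0 \<and> free_gamma_F (of_real (- c)) = 1 / \<alpha>)"

definition free_gamma_v :: "real \<Rightarrow> real \<Rightarrow> real" where
  "free_gamma_v \<alpha> x =
     (if x \<le> - free_gamma_c \<alpha> then 0
      else (THE y. y > 0 \<and> free_gamma_F (Complex x y) = 1 / \<alpha>))"

(* free_gamma_H \<alpha> is real-valued on the graph of free_gamma_v \<alpha>, so taking Re here
   only changes the type. *)
definition free_gamma_P :: "real \<Rightarrow> real \<Rightarrow> real" where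
  "free_gamma_P \<alpha> x = Re (free_gamma_H \<alpha> (Complex x (free_gamma_v \<alpha> x)))"

definition free_gamma_s :: "real \<Rightarrow> real" where
  "free_gamma_s \<alpha> = free_gamma_P \<alpha> (- free_gamma_c \<alpha>)"

definition free_gamma_Q :: "real \<Rightarrow> real \<Rightarrow> real" where
  "free_gamma_Q \<alpha> x = free_gamma_v \<alpha> x / (x\<^sup>2 + (free_gamma_v \<alpha> x)\<^sup>2)"

(* The everywhere-defined version of the Lebesgue density of the free Gamma distribution with
   parameter \<alpha> > 0, i.e. of the image of the classical Gamma law under the Bercovici-Pata
   bijection.  It comes from Stieltjes inversion: the Cauchy transform G of that law satisfies
   free_gamma_H \<alpha> (1 / G z) = z on the upper half-plane. *)
definition free_gamma_density :: "real \<Rightarrow> real \<Rightarrow> real" where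
  "free_gamma_density \<alpha> \<xi> =
     (if \<xi> \<le> free_gamma_s \<alpha> then 0
      else 1 / pi * free_gamma_Q \<alpha> (inv (free_gamma_P \<alpha>) \<xi>))"

end

theory Submission
  imports Defs "HOL-Probability.Sinc_Integral"
begin

text \<open>
  Fix \<open>x > 0\<close> and write \<open>u\<close> for a preimage of \<open>x\<close> under \<open>P\<close> and \<open>v\<close> for the height above \<open>u\<close>, so
  that \<open>F (u + iv) = 1 / \<alpha>\<close>. This equation turns the quantity of interest into a Poisson integral:
  \<open>1 / \<alpha>\<close> times the density at \<open>x\<close> is
  \[ \frac{1}{\pi} \cdot \frac{v/\alpha}{u^2 + v^2}
     = \frac{1}{\pi} \cdot \frac{v\,F(u + iv)}{u^2 + v^2}, \qquad
     v\,F(u + iv) = \int_0^\infty t e^{-t} \frac{v}{(u - t)^2 + v^2}\,dt . \]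
  The Poisson integral of the bounded continuous function \<open>t e\<^sup>-\<^sup>t\<close> (extended by \<open>0\<close>) tends to \<open>\<pi>\<close> times
  its boundary value, however \<open>u + iv\<close> approaches the boundary point
  (\<open>poisson_boundary_limit\<close>). So everything follows once \<open>u \<rightarrow> x\<close> and \<open>v \<rightarrow> 0\<close>: the limit is
  \<open>x e\<^sup>-\<^sup>x / x\<^sup>2\<close>.

  That \<open>v \<le> sqrt \<alpha>\<close> is immediate from \<open>F (u + iv) \<le> 1 / v\<^sup>2\<close>. For \<open>u\<close>, the
  relation \<open>F \<le> 1 / \<alpha>\<close>, valid on the graph of \<open>v\<close>, and the inequality of arithmetic and geometric
  means give \<open>\<bar>P w - w - \<alpha>\<bar> \<le> sqrt \<alpha>\<close> for every real \<open>w\<close> (\<open>free_gamma_P_near_identity\<close>). This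
  single estimate localizes every preimage of \<open>x\<close> near \<open>x\<close>, shows that \<open>s\<close> lies below \<open>x\<close> for small
  \<open>\<alpha>\<close>, and, with the continuity of \<open>P\<close> and the intermediate value theorem, produces a preimage.

  The rest is the justification of the definitions of \<open>c\<close> and \<open>v\<close>: \<open>F\<close> is continuous off the closed
  positive half-line, strictly decreasing along the rays involved, small far out, and above \<open>1 / \<alpha>\<close>
  near the real axis to the right of \<open>- c\<close>.
\<close>

section \<open>Integrals against the Gamma law of shape two\<close>

text \<open>
  Absorbing the weight \<open>t e\<^sup>-\<^sup>t\<close> into the Gamma probability law of shape two leaves only integrals of
  functions of \<open>z - t\<close>, which are bounded when \<open>z\<close> is off the closed positive half-line.
\<close>

definition gamma2 :: "real measure" where
  "gamma2 = density lborel (erlang_density (Suc 0) 1)"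

interpretation gamma2: prob_space gamma2
  unfolding gamma2_def by (rule prob_space_erlang_density) simp

lemma sets_gamma2 [measurable_cong, simp]: "sets gamma2 = sets borel"
  and space_gamma2 [simp]: "space gamma2 = UNIV"
  by (simp_all add: gamma2_def)

lemma erlang_1_1: "erlang_density (Suc 0) 1 t = indicator {0..} t * (t * exp (- t))"
  by (auto simp: erlang_density_def)

lemma AE_gamma2_nonneg: "AE t in gamma2. 0 \<le> t"
  unfolding gamma2_def by (subst AE_density) (auto simp: erlang_density_def)

lemma integral_gamma2:
  fixes f :: "real \<Rightarrow> 'b :: {banach, second_countable_topology}"
  assumes "f \<in> borel_measurable borel"
  shows "(\<integral>t. f t \<partial>gamma2) = (\<integral>t. erlang_density (Suc 0) 1 t *\<^sub>R f t \<partial>lborel)"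
  unfolding gamma2_def using assms by (subst integral_density) auto

lemma free_gamma_F_eq:
  "free_gamma_F z = (\<integral>t. 1 / (cmod (z - of_real t))\<^sup>2 \<partial>gamma2)"
  unfolding free_gamma_F_def set_lebesgue_integral_def
  by (subst integral_gamma2) (auto simp: erlang_1_1 intro!: Bochner_Integration.integral_cong)

lemma free_gamma_H_eq:
  "free_gamma_H \<alpha> z = z + of_real \<alpha> + of_real \<alpha> * (\<integral>t. 1 / (z - of_real t) \<partial>gamma2)"
  unfolding free_gamma_H_def set_lebesgue_integral_def
  by (subst integral_gamma2)
     (auto simp: erlang_1_1 scaleR_conv_of_real indicator_def
           intro!: Bochner_Integration.integral_cong)

lemma off_half_line_distance:
  assumes "z \<notin> \<real>\<^sub>\<ge>\<^sub>0"
  obtains \<delta> where "\<delta> > 0" "\<And>t. 0 \<le> t \<Longrightarrow> \<delta> \<le> cmod (z - of_real t)"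
  using separate_point_closed[OF closed_nonneg_Reals_complex assms] that
  by (metis dist_norm nonneg_Reals_of_real_iff)

lemma integrable_kernel:
  fixes \<phi> :: "complex \<Rightarrow> 'b :: {banach, second_countable_topology}"
  assumes [measurable]: "\<phi> \<in> borel_measurable borel"
    and bd: "\<And>\<delta>. \<delta> > 0 \<Longrightarrow> \<exists>B. \<forall>w. \<delta> \<le> cmod w \<longrightarrow> norm (\<phi> w) \<le> B"
    and z: "z \<notin> \<real>\<^sub>\<ge>\<^sub>0"
  shows "integrable gamma2 (\<lambda>t. \<phi> (z - of_real t))"
proof -
  obtain \<delta> where \<delta>: "\<delta> > 0" "\<And>t. 0 \<le> t \<Longrightarrow> \<delta> \<le> cmod (z - of_real t)"
    using off_half_line_distance[OF z] by blast
  obtain B where B: "\<And>w. \<delta> \<le> cmod w \<Longrightarrow> norm (\<phi> w) \<le> B" using bd[OF \<delta>(1)] by blast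
  show ?thesis
    by (rule gamma2.integrable_const_bound[where B = B])
       (use AE_gamma2_nonneg in \<open>auto elim!: eventually_mono intro!: B \<delta>\<close>)
qed

text \<open>
  Close to \<open>z\<close> all distances to the half-line stay above a common \<open>\<delta> / 2\<close>, so the kernel is bounded
  there by one constant and dominated convergence applies. Used with \<open>1 / \<bar>w\<bar>\<^sup>2\<close> for \<open>F\<close> and
  \<open>1 / w\<close> for \<open>H\<close>.
\<close>

lemma isCont_kernel_integral:
  fixes \<phi> :: "complex \<Rightarrow> 'b :: {banach, second_countable_topology}"
  assumes [measurable]: "\<phi> \<in> borel_measurable borel"
    and bd: "\<And>\<delta>. \<delta> > 0 \<Longrightarrow> \<exists>B. \<forall>w. \<delta> \<le> cmod w \<longrightarrow> norm (\<phi> w) \<le> B"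
    and cont: "\<And>w. w \<noteq> 0 \<Longrightarrow> isCont \<phi> w"
    and z: "z \<notin> \<real>\<^sub>\<ge>\<^sub>0"
  shows "isCont (\<lambda>z. \<integral>t. \<phi> (z - of_real t) \<partial>gamma2) z"
proof -
  obtain \<delta> where \<delta>: "\<delta> > 0" "\<And>t. 0 \<le> t \<Longrightarrow> \<delta> \<le> cmod (z - of_real t)"
    using off_half_line_distance[OF z] by blast
  obtain B where B: "\<And>w. \<delta> / 2 \<le> cmod w \<Longrightarrow> norm (\<phi> w) \<le> B" using bd[of "\<delta> / 2"] \<delta> by auto
  have far: "\<delta> / 2 \<le> cmod (w - of_real t)" if "w \<in> ball z (\<delta> / 2)" "0 \<le> t" for w t
  proof -
    have "cmod (z - of_real t) \<le> cmod (z - w) + cmod (w - of_real t)"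
      using norm_triangle_ineq[of "z - w" "w - of_real t"] by simp
    with \<delta>(2)[OF that(2)] that(1) show ?thesis by (simp add: dist_norm)
  qed
  have "continuous_on (ball z (\<delta> / 2)) (\<lambda>z. \<integral>t. \<phi> (z - of_real t) \<partial>gamma2)"
    unfolding continuous_on_sequentially
  proof (intro allI ballI impI, elim conjE)
    fix X a assume a: "a \<in> ball z (\<delta> / 2)" and X: "\<forall>n::nat. X n \<in> ball z (\<delta> / 2)" "X \<longlonglongrightarrow> a"
    have "(\<lambda>n. \<integral>t. \<phi> (X n - of_real t) \<partial>gamma2) \<longlonglongrightarrow> (\<integral>t. \<phi> (a - of_real t) \<partial>gamma2)"
    proof (rule integral_dominated_convergence[where w = "\<lambda>_. B"])
      show "AE t in gamma2. (\<lambda>n. \<phi> (X n - of_real t)) \<longlonglongrightarrow> \<phi> (a - of_real t)"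
        using AE_gamma2_nonneg
      proof (rule eventually_mono)
        fix t :: real assume "0 \<le> t"
        then have "a - of_real t \<noteq> 0" using far[OF a, of t] \<delta>(1) by auto
        then show "(\<lambda>n. \<phi> (X n - of_real t)) \<longlonglongrightarrow> \<phi> (a - of_real t)"
          by (intro isCont_tendsto_compose[OF cont] tendsto_intros X)
      qed
      show "AE t in gamma2. norm (\<phi> (X n - of_real t)) \<le> B" for n
        using AE_gamma2_nonneg by (rule eventually_mono) (use X far B in auto)
    qed auto
    then show "((\<lambda>z. \<integral>t. \<phi> (z - of_real t) \<partial>gamma2) \<circ> X) \<longlonglongrightarrow> (\<integral>t. \<phi> (a - of_real t) \<partial>gamma2)"
      by (simp add: o_def)
  qed
  then show ?thesis using \<delta>(1) by (simp add: continuous_on_eq_continuous_at)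
qed

lemma inverse_norm_power_bounded:
  assumes "\<delta> > 0"
  shows "\<exists>B. \<forall>w :: complex. \<delta> \<le> cmod w \<longrightarrow> 1 / cmod w ^ n \<le> B"
proof (intro exI allI impI)
  fix w :: complex assume "\<delta> \<le> cmod w"
  with assms show "1 / cmod w ^ n \<le> 1 / \<delta> ^ n"
    by (intro divide_left_mono power_mono mult_pos_pos zero_less_power) auto
qed

lemma integrable_F: "z \<notin> \<real>\<^sub>\<ge>\<^sub>0 \<Longrightarrow> integrable gamma2 (\<lambda>t. 1 / (cmod (z - of_real t))\<^sup>2)"
  by (rule integrable_kernel[where \<phi> = "\<lambda>w. 1 / (cmod w)\<^sup>2"])
     (use inverse_norm_power_bounded[of _ 2] in auto)

lemma isCont_free_gamma_F: "z \<notin> \<real>\<^sub>\<ge>\<^sub>0 \<Longrightarrow> isCont free_gamma_F z"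
  unfolding free_gamma_F_eq
  by (rule isCont_kernel_integral[where \<phi> = "\<lambda>w. 1 / (cmod w)\<^sup>2"])
     (use inverse_norm_power_bounded[of _ 2] in \<open>auto intro!: continuous_intros\<close>)

lemma isCont_free_gamma_H: "z \<notin> \<real>\<^sub>\<ge>\<^sub>0 \<Longrightarrow> isCont (free_gamma_H \<alpha>) z"
  unfolding free_gamma_H_eq
  by (intro continuous_intros isCont_kernel_integral[where \<phi> = "\<lambda>w. 1 / w"])
     (use inverse_norm_power_bounded[of _ 1] in \<open>auto simp: norm_divide intro!: continuous_intros\<close>)

section \<open>Monotonicity and size of \<open>F\<close>\<close>

lemma free_gamma_F_mono:
  assumes "z \<notin> \<real>\<^sub>\<ge>\<^sub>0" "w \<notin> \<real>\<^sub>\<ge>\<^sub>0" "\<And>t. 0 \<le> t \<Longrightarrow> cmod (z - of_real t) \<le> cmod (w - of_real t)"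
  shows "free_gamma_F w \<le> free_gamma_F z"
  unfolding free_gamma_F_eq
proof (rule integral_mono_AE[OF integrable_F integrable_F])
  show "AE t in gamma2. 1 / (cmod (w - of_real t))\<^sup>2 \<le> 1 / (cmod (z - of_real t))\<^sup>2"
    using AE_gamma2_nonneg
  proof (rule eventually_mono)
    fix t :: real assume "0 \<le> t"
    moreover from this assms(1,2) have "0 < cmod (z - of_real t)" "0 < cmod (w - of_real t)" by auto
    ultimately show "1 / (cmod (w - of_real t))\<^sup>2 \<le> 1 / (cmod (z - of_real t))\<^sup>2"
      using assms(3) by (intro divide_left_mono power_mono mult_pos_pos zero_less_power) auto
  qed
qed (use assms in auto)

lemma free_gamma_F_strict_mono:
  assumes "z \<notin> \<real>\<^sub>\<ge>\<^sub>0" "w \<notin> \<real>\<^sub>\<ge>\<^sub>0" "\<And>t. 0 \<le> t \<Longrightarrow> cmod (z - of_real t) < cmod (w - of_real t)"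
  shows "free_gamma_F w < free_gamma_F z"
  unfolding free_gamma_F_eq
proof (rule gamma2.integral_less_AE_space[OF integrable_F integrable_F])
  show "AE t in gamma2. 1 / (cmod (w - of_real t))\<^sup>2 < 1 / (cmod (z - of_real t))\<^sup>2"
    using AE_gamma2_nonneg
  proof (rule eventually_mono)
    fix t :: real assume "0 \<le> t"
    moreover from this assms(1,2) have "0 < cmod (z - of_real t)" "0 < cmod (w - of_real t)" by auto
    ultimately show "1 / (cmod (w - of_real t))\<^sup>2 < 1 / (cmod (z - of_real t))\<^sup>2"
      using assms(3)
      by (intro divide_strict_left_mono power_strict_mono mult_pos_pos zero_less_power) auto
  qed
  show "emeasure gamma2 (space gamma2) \<noteq> 0"
    using gamma2.emeasure_space_1 by simp
qed (use assms in auto)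

lemma free_gamma_F_upper:
  assumes "\<delta> > 0" "\<And>t. 0 \<le> t \<Longrightarrow> \<delta> \<le> cmod (z - of_real t)"
  shows "free_gamma_F z \<le> 1 / \<delta>\<^sup>2"
proof -
  have "free_gamma_F z \<le> (\<integral>t. 1 / \<delta>\<^sup>2 \<partial>gamma2)"
    unfolding free_gamma_F_eq
  proof (rule integral_mono_AE')
    show "AE t in gamma2. 1 / (cmod (z - of_real t))\<^sup>2 \<le> 1 / \<delta>\<^sup>2"
      using AE_gamma2_nonneg
    proof (rule eventually_mono)
      fix t :: real assume "0 \<le> t"
      with assms(2) have "\<delta> \<le> cmod (z - of_real t)" by auto
      with assms(1) show "1 / (cmod (z - of_real t))\<^sup>2 \<le> 1 / \<delta>\<^sup>2"
        by (intro divide_left_mono power_mono mult_pos_pos zero_less_power) auto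
    qed
  qed (use assms in auto)
  then show ?thesis using gamma2.prob_space by simp
qed

lemma free_gamma_F_vertical_strict:
  assumes "0 < y" "y < y'"
  shows "free_gamma_F (Complex x y') < free_gamma_F (Complex x y)"
proof (rule free_gamma_F_strict_mono)
  show "cmod (Complex x y - of_real t) < cmod (Complex x y' - of_real t)" for t
    using assms by (auto simp: cmod_def intro!: power_strict_mono)
qed (use assms in \<open>auto simp: complex_nonneg_Reals_iff\<close>)

lemma free_gamma_F_negative_strict:
  assumes "0 < c" "c < c'"
  shows "free_gamma_F (of_real (- c')) < free_gamma_F (of_real (- c))"
proof (rule free_gamma_F_strict_mono)
  show "cmod (of_real (- c) - of_real t) < cmod (of_real (- c') - of_real t)" if "0 \<le> t" for t
    using assms that by (simp flip: of_real_diff of_real_minus)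
qed (use assms in \<open>auto simp: complex_nonneg_Reals_iff\<close>)

text \<open>
  On \<open>{c..1}\<close> one has \<open>(c + t)\<^sup>2 \<le> 4 t\<^sup>2\<close> and \<open>e\<^sup>-\<^sup>t \<ge> e\<^sup>-\<^sup>1\<close>, so the integrand is at least a constant times
  \<open>1 / t\<close>. The resulting logarithmic divergence makes \<open>F (- c)\<close> reach every level as \<open>c \<rightarrow> 0\<close>.
\<close>

lemma free_gamma_F_near_zero:
  assumes "0 < c" "c \<le> 1"
  shows "exp (- 1) / 4 * - ln c \<le> free_gamma_F (of_real (- c))"
proof -
  have FTC: "has_bochner_integral lborel (\<lambda>t. exp (- 1) / (4 * t) * indicator {c..1} t)
     (exp (- 1) / 4 * ln 1 - exp (- 1) / 4 * ln c)"
    using assms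
    by (intro has_bochner_integral_FTC_Icc_real)
       (auto intro!: derivative_eq_intros continuous_intros)
  have eq: "free_gamma_F (of_real (- c)) =
     (\<integral>t. erlang_density (Suc 0) 1 t * (1 / (cmod (of_real (- c) - of_real t))\<^sup>2) \<partial>lborel)"
    unfolding free_gamma_F_eq by (subst integral_gamma2) auto
  have "of_real (- c) \<notin> (\<real>\<^sub>\<ge>\<^sub>0 :: complex set)"
    using assms by (simp add: complex_nonneg_Reals_iff)
  from integrable_F[OF this]
  have int: "integrable lborel (\<lambda>t. erlang_density (Suc 0) 1 t * (1 / (cmod (of_real (- c) - of_real t))\<^sup>2))"
    unfolding gamma2_def by (subst (asm) integrable_density) auto
  have "(\<integral>t. exp (- 1) / (4 * t) * indicator {c..1} t \<partial>lborel) \<le> free_gamma_F (of_real (- c))"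
    unfolding eq
  proof (rule integral_mono[OF _ int])
    fix t :: real
    show "exp (- 1) / (4 * t) * indicator {c..1} t
       \<le> erlang_density (Suc 0) 1 t * (1 / (cmod (of_real (- c) - of_real t))\<^sup>2)"
    proof (cases "t \<in> {c..1}")
      case True
      then have t: "0 < t" "c \<le> t" "t \<le> 1" using assms by auto
      have "exp (- 1) / (4 * t) = t * exp (- 1) / (2 * t)\<^sup>2"
        using t by (simp add: power2_eq_square)
      also have "\<dots> \<le> t * exp (- t) / (c + t)\<^sup>2"
        using t assms by (intro frac_le mult_left_mono power_mono) auto
      also have "(c + t)\<^sup>2 = (cmod (of_real (- c) - of_real t))\<^sup>2"
        by (simp flip: of_real_diff of_real_minus) (simp add: power2_eq_square algebra_simps)
      finally show ?thesis using t True by (simp add: erlang_1_1)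
    qed (auto simp: erlang_density_def)
  qed (use FTC in \<open>auto simp: has_bochner_integral_iff\<close>)
  then show ?thesis using FTC by (simp add: has_bochner_integral_iff)
qed

section \<open>The point \<open>c\<close>\<close>

text \<open>
  The common form of the two definite descriptions: \<open>c\<close> and \<open>v\<close> are both the unique place where a
  continuous strictly decreasing function takes the value \<open>1 / \<alpha>\<close>.
\<close>

lemma IVT_antitone_level:
  fixes h :: "real \<Rightarrow> real"
  assumes y0: "0 < y0" "K \<le> h y0" and y1: "0 < y1" "h y1 \<le> K"
    and cont: "\<And>y. 0 < y \<Longrightarrow> isCont h y"
    and anti: "\<And>y y'. 0 < y \<Longrightarrow> y < y' \<Longrightarrow> h y' < h y"
  shows "\<exists>!y. 0 < y \<and> h y = K"
proof -
  have "y0 \<le> y1" using anti[of y1 y0] y0 y1 by force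
  then obtain y where "y0 \<le> y" "h y = K"
    using IVT2[of h y1 K y0] y0 y1 cont by auto
  moreover have "y = y'" if "0 < y" "0 < y'" "h y = h y'" for y y'
    using anti[of y y'] anti[of y' y] that by (cases y y' rule: linorder_cases) auto
  ultimately show ?thesis using y0 by (intro ex1I[of _ y]) auto
qed

lemma free_gamma_c:
  assumes "\<alpha> > 0"
  shows "0 < free_gamma_c \<alpha>" "free_gamma_F (of_real (- free_gamma_c \<alpha>)) = 1 / \<alpha>"
proof -
  \<comment> \<open>The solution of \<open>e\<^sup>-\<^sup>1 / 4 * - ln c0 = 1 / \<alpha>\<close>, so that the logarithmic bound reaches the level.\<close>
  define c0 where "c0 = exp (- (4 * exp 1 / \<alpha>))"
  have "1 / \<alpha> = exp (- 1) / 4 * - ln c0"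
    unfolding c0_def ln_exp using assms by (simp add: exp_minus field_simps)
  then have "1 / \<alpha> \<le> free_gamma_F (of_real (- c0))"
    using free_gamma_F_near_zero[of c0] assms by (simp add: c0_def)
  moreover have "free_gamma_F (of_real (- sqrt \<alpha>)) \<le> 1 / (sqrt \<alpha>)\<^sup>2"
    using assms by (intro free_gamma_F_upper) (simp_all flip: of_real_diff of_real_minus)
  moreover have "isCont (\<lambda>c. free_gamma_F (of_real (- c))) c" if "0 < c" for c
    using that by (intro isCont_o2[OF _ isCont_free_gamma_F])
       (auto simp: complex_nonneg_Reals_iff intro!: continuous_intros)
  ultimately have "\<exists>!c. c > 0 \<and> free_gamma_F (of_real (- c)) = 1 / \<alpha>"
    using assms free_gamma_F_negative_strict
    by (intro IVT_antitone_level[of c0 _ _ "sqrt \<alpha>"]) (auto simp: c0_def)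
  from theI'[OF this] show "0 < free_gamma_c \<alpha>" "free_gamma_F (of_real (- free_gamma_c \<alpha>)) = 1 / \<alpha>"
    by (simp_all add: free_gamma_c_def)
qed

section \<open>Boundary behaviour of the Poisson integral\<close>

lemma integrable_Cauchy_kernel: "integrable lborel (\<lambda>s::real. 1 / (1 + s\<^sup>2))"
  and integral_Cauchy_kernel: "(\<integral>s. 1 / (1 + s\<^sup>2) \<partial>(lborel :: real measure)) = pi"
  using integrable_inverse_1_plus_square LBINT_inverse_1_plus_square
  by (simp_all add: set_integrable_def interval_lebesgue_integral_def set_lebesgue_integral_def
       inverse_eq_divide)

lemma erlang_1_1_bounds: "0 \<le> erlang_density (Suc 0) 1 t" "erlang_density (Suc 0) 1 t \<le> 1"
proof -
  show "erlang_density (Suc 0) 1 t \<le> 1"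
  proof (cases "t < 0")
    case False
    have "t \<le> exp t" using exp_ge_add_one_self[of t] by linarith
    with False show ?thesis by (simp add: erlang_density_def exp_minus field_simps)
  qed (simp add: erlang_density_def)
qed simp

lemma isCont_erlang_1_1: "isCont (erlang_density (Suc 0) 1) t"
proof -
  have "erlang_density (Suc 0) 1 = (\<lambda>t. max 0 t * exp (- t))"
    by (auto simp: erlang_density_def fun_eq_iff max_def)
  then show ?thesis by (auto intro!: continuous_intros)
qed

text \<open>
  The substitution \<open>t = x + y s\<close> moves the dependence on \<open>x + iy\<close> from the Poisson kernel into the
  argument of the density, which is bounded and continuous.
\<close>

lemma free_gamma_F_rescaled:
  assumes "0 < y"
  shows "y * free_gamma_F (Complex x y) = (\<integral>s. erlang_density (Suc 0) 1 (x + y * s) * (1 / (1 + s\<^sup>2)) \<partial>lborel)"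
proof -
  have "free_gamma_F (Complex x y) =
     (\<integral>t. erlang_density (Suc 0) 1 t * (1 / (cmod (Complex x y - of_real t))\<^sup>2) \<partial>lborel)"
    unfolding free_gamma_F_eq by (subst integral_gamma2) auto
  also have "\<dots> = y * (\<integral>s. erlang_density (Suc 0) 1 (x + y * s) *
      (1 / (cmod (Complex x y - of_real (x + y * s)))\<^sup>2) \<partial>lborel)"
    using assms by (subst lborel_integral_real_affine[of y _ x]) auto
  finally have "y * free_gamma_F (Complex x y) = (\<integral>s. y\<^sup>2 * (erlang_density (Suc 0) 1 (x + y * s) *
      (1 / (cmod (Complex x y - of_real (x + y * s)))\<^sup>2)) \<partial>lborel)"
    by (simp only: power2_eq_square integral_mult_right_zero mult.assoc)
  also have "\<dots> = (\<integral>s. erlang_density (Suc 0) 1 (x + y * s) * (1 / (1 + s\<^sup>2)) \<partial>lborel)"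
  proof (rule Bochner_Integration.integral_cong)
    fix s :: real
    have "(cmod (Complex x y - of_real (x + y * s)))\<^sup>2 = y\<^sup>2 * (1 + s\<^sup>2)"
      by (simp add: cmod_power2 algebra_simps)
    moreover have "1 + s\<^sup>2 \<noteq> 0" using zero_le_power2[of s] by linarith
    ultimately show "y\<^sup>2 * (erlang_density (Suc 0) 1 (x + y * s) *
        (1 / (cmod (Complex x y - of_real (x + y * s)))\<^sup>2)) =
        erlang_density (Suc 0) 1 (x + y * s) * (1 / (1 + s\<^sup>2))"
      using assms by simp
  qed simp
  finally show ?thesis .
qed

text \<open>
  The rescaled integrand is dominated by the Cauchy kernel, whose integral is \<open>\<pi>\<close>. The approach to the
  boundary is unrestricted, since \<open>u\<close> and \<open>v\<close> later vary with \<open>\<alpha>\<close> at unrelated rates.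
\<close>

lemma poisson_boundary_limit:
  "((\<lambda>z. Im z * free_gamma_F z) \<longlongrightarrow> pi * erlang_density (Suc 0) 1 x) (at (of_real x) within {z. 0 < Im z})"
  unfolding tendsto_at_iff_sequentially
proof (intro allI impI)
  fix Z :: "nat \<Rightarrow> complex"
  assume Z: "\<forall>n. Z n \<in> {z. 0 < Im z} - {of_real x}" "Z \<longlonglongrightarrow> of_real x"
  have lim: "(\<lambda>n. Re (Z n)) \<longlonglongrightarrow> x" "(\<lambda>n. Im (Z n)) \<longlonglongrightarrow> 0"
    using tendsto_Re[OF Z(2)] tendsto_Im[OF Z(2)] by simp_all
  have "(\<lambda>n. \<integral>s. erlang_density (Suc 0) 1 (Re (Z n) + Im (Z n) * s) * (1 / (1 + s\<^sup>2)) \<partial>lborel)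
     \<longlonglongrightarrow> (\<integral>s. erlang_density (Suc 0) 1 x * (1 / (1 + s\<^sup>2)) \<partial>lborel)"
  proof (rule integral_dominated_convergence[where w = "\<lambda>s. 1 / (1 + s\<^sup>2)"])
    show "AE s in lborel. (\<lambda>n. erlang_density (Suc 0) 1 (Re (Z n) + Im (Z n) * s) * (1 / (1 + s\<^sup>2)))
       \<longlonglongrightarrow> erlang_density (Suc 0) 1 x * (1 / (1 + s\<^sup>2))"
    proof (rule AE_I2)
      fix s :: real
      have "(\<lambda>n. Re (Z n) + Im (Z n) * s) \<longlonglongrightarrow> x + 0 * s"
        by (intro tendsto_intros lim)
      then show "(\<lambda>n. erlang_density (Suc 0) 1 (Re (Z n) + Im (Z n) * s) * (1 / (1 + s\<^sup>2)))
       \<longlonglongrightarrow> erlang_density (Suc 0) 1 x * (1 / (1 + s\<^sup>2))"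
        by (intro tendsto_mult_right isCont_tendsto_compose[OF isCont_erlang_1_1]) simp
    qed
    show "AE s in lborel. norm (erlang_density (Suc 0) 1 (Re (Z n) + Im (Z n) * s) * (1 / (1 + s\<^sup>2)))
       \<le> 1 / (1 + s\<^sup>2)" for n
    proof (rule AE_I2)
      fix s :: real
      show "norm (erlang_density (Suc 0) 1 (Re (Z n) + Im (Z n) * s) * (1 / (1 + s\<^sup>2))) \<le> 1 / (1 + s\<^sup>2)"
        using mult_right_mono[OF erlang_1_1_bounds(2), of "1 / (1 + s\<^sup>2)"]
        by (simp add: abs_mult)
    qed
  qed (auto intro: integrable_Cauchy_kernel)
  moreover have "Im (Z n) * free_gamma_F (Z n) =
      (\<integral>s. erlang_density (Suc 0) 1 (Re (Z n) + Im (Z n) * s) * (1 / (1 + s\<^sup>2)) \<partial>lborel)" for n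
    using free_gamma_F_rescaled[of "Im (Z n)" "Re (Z n)"] Z(1) by simp
  ultimately show "((\<lambda>z. Im z * free_gamma_F z) \<circ> Z) \<longlonglongrightarrow> pi * erlang_density (Suc 0) 1 x"
    by (simp only: o_def integral_mult_right_zero integral_Cauchy_kernel mult.commute[of pi])
qed

section \<open>The height \<open>v\<close>\<close>

text \<open>
  For \<open>x \<le> 0\<close> the triangle inequality \<open>\<bar>x + iy - t\<bar> \<le> \<bar>x\<bar> + y + t\<close> compares \<open>F (x + iy)\<close> with
  \<open>F (- c) = 1 / \<alpha>\<close> as soon as \<open>\<bar>x\<bar> + y \<le> c\<close>. For \<open>x > 0\<close> the product \<open>y F (x + iy)\<close> has a positive
  limit as \<open>y \<rightarrow> 0\<close>, so \<open>F\<close> itself blows up.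
\<close>

lemma free_gamma_F_vertical_large:
  assumes "\<alpha> > 0" "- free_gamma_c \<alpha> < x"
  shows "\<exists>y>0. 1 / \<alpha> \<le> free_gamma_F (Complex x y)"
proof (cases "x \<le> 0")
  case True
  define y where "y = (free_gamma_c \<alpha> + x) / 2"
  have y: "0 < y" "y - x \<le> free_gamma_c \<alpha>" using assms True by (auto simp: y_def)
  have "free_gamma_F (of_real (- free_gamma_c \<alpha>)) \<le> free_gamma_F (Complex x y)"
  proof (rule free_gamma_F_mono)
    fix t :: real assume "0 \<le> t"
    have "cmod (Complex x y - of_real t) \<le> \<bar>x - t\<bar> + \<bar>y\<bar>"
      using cmod_le[of "Complex x y - of_real t"] by simp
    also have "\<dots> \<le> free_gamma_c \<alpha> + t" using y True \<open>0 \<le> t\<close> by simp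
    also have "\<dots> = cmod (of_real (- free_gamma_c \<alpha>) - of_real t)"
      using free_gamma_c(1)[OF assms(1)] \<open>0 \<le> t\<close> by (simp flip: of_real_diff of_real_minus)
    finally show "cmod (Complex x y - of_real t) \<le> cmod (of_real (- free_gamma_c \<alpha>) - of_real t)" .
  qed (use y free_gamma_c(1)[OF assms(1)] in \<open>auto simp: complex_nonneg_Reals_iff\<close>)
  then show ?thesis using y free_gamma_c(2)[OF assms(1)] by auto
next
  case False
  let ?m = "pi * erlang_density (Suc 0) 1 x"
  have m: "0 < ?m" using False by (simp add: erlang_density_def)
  have "((\<lambda>y. Complex x y) \<longlongrightarrow> of_real x) (at_right 0)"
    by (auto simp: tendsto_complex_iff)
  then have "filterlim (\<lambda>y. Complex x y) (at (of_real x) within {z. 0 < Im z}) (at_right 0)"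
    by (auto simp: filterlim_at complex_eq_iff eventually_at_right_less eventually_at_topological)
  from filterlim_compose[OF poisson_boundary_limit this]
  have lim: "((\<lambda>y. y * free_gamma_F (Complex x y)) \<longlongrightarrow> ?m) (at_right 0)" by simp
  have "\<forall>\<^sub>F y in at_right 0. ?m / 2 < y * free_gamma_F (Complex x y)"
    by (rule order_tendstoD(1)[OF lim]) (use m in linarith)
  moreover have "\<forall>\<^sub>F y in at_right 0. y < \<alpha> * ?m / 2"
    using assms m by (intro order_tendstoD(2)[of _ 0]) auto
  moreover have "\<forall>\<^sub>F y::real in at_right 0. 0 < y"
    by (rule eventually_at_right_less)
  ultimately have "\<forall>\<^sub>F y in at_right 0. 0 < y \<and> 1 / \<alpha> \<le> free_gamma_F (Complex x y)"
  proof eventually_elim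
    case (elim y)
    have "y / \<alpha> \<le> ?m / 2" using elim assms by (simp add: field_simps)
    with elim have "y * (1 / \<alpha>) \<le> y * free_gamma_F (Complex x y)" by (simp only: mult_1_right times_divide_eq_right)
    with elim show ?case by (simp only: mult_le_cancel_left_pos simp_thms)
  qed
  then show ?thesis using eventually_happens[of _ "at_right (0::real)"] by auto
qed

lemma isCont_free_gamma_F_Complex:
  "0 < y \<Longrightarrow> isCont (\<lambda>y. free_gamma_F (Complex x y)) y"
  "0 < y \<Longrightarrow> isCont (\<lambda>x. free_gamma_F (Complex x y)) x"
  by (rule isCont_o2[OF _ isCont_free_gamma_F];
      simp add: complex_nonneg_Reals_iff isCont_def tendsto_complex_iff)+

lemma free_gamma_v:
  assumes "\<alpha> > 0" "- free_gamma_c \<alpha> < x"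
  shows "0 < free_gamma_v \<alpha> x" "free_gamma_F (Complex x (free_gamma_v \<alpha> x)) = 1 / \<alpha>"
proof -
  obtain y0 where "0 < y0" "1 / \<alpha> \<le> free_gamma_F (Complex x y0)"
    using free_gamma_F_vertical_large[OF assms] by blast
  moreover have "free_gamma_F (Complex x (sqrt \<alpha>)) \<le> 1 / (sqrt \<alpha>)\<^sup>2"
  proof (rule free_gamma_F_upper)
    show "sqrt \<alpha> \<le> cmod (Complex x (sqrt \<alpha>) - of_real t)" for t
      using abs_Im_le_cmod[of "Complex x (sqrt \<alpha>) - of_real t"] by simp
  qed (use assms in simp)
  ultimately have "\<exists>!y. y > 0 \<and> free_gamma_F (Complex x y) = 1 / \<alpha>"
    using assms free_gamma_F_vertical_strict isCont_free_gamma_F_Complex(1)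
    by (intro IVT_antitone_level[of y0 _ _ "sqrt \<alpha>"]) auto
  from theI'[OF this] assms(2)
  show "0 < free_gamma_v \<alpha> x" "free_gamma_F (Complex x (free_gamma_v \<alpha> x)) = 1 / \<alpha>"
    by (simp_all add: free_gamma_v_def)
qed

lemma free_gamma_v_le:
  assumes "\<alpha> > 0" "- free_gamma_c \<alpha> < x"
  shows "free_gamma_v \<alpha> x \<le> sqrt \<alpha>"
proof -
  let ?y = "free_gamma_v \<alpha> x"
  note v = free_gamma_v[OF assms]
  have "1 / \<alpha> \<le> 1 / ?y\<^sup>2"
    unfolding v(2)[symmetric]
  proof (rule free_gamma_F_upper)
    show "?y \<le> cmod (Complex x ?y - of_real t)" for t
      using abs_Im_le_cmod[of "Complex x ?y - of_real t"] by simp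
  qed (rule v)
  then have "?y\<^sup>2 \<le> \<alpha>" using assms(1) v(1) by (simp add: field_simps)
  then show ?thesis by (rule real_le_rsqrt)
qed

text \<open>
  The horizontal continuity of \<open>F\<close> at a height \<open>a\<close> just below or above \<open>v x\<close> keeps \<open>F\<close> on the same
  side of the level \<open>1 / \<alpha>\<close> for nearby points, and vertical monotonicity then keeps \<open>v\<close> on the same
  side of \<open>a\<close>.
\<close>

lemma isCont_free_gamma_v:
  assumes "\<alpha> > 0" "- free_gamma_c \<alpha> < x"
  shows "isCont (free_gamma_v \<alpha>) x"
  unfolding isCont_def
proof (rule order_tendstoI)
  note v = free_gamma_v[OF assms]
  have dom: "\<forall>\<^sub>F u in at x. - free_gamma_c \<alpha> < u"
    by (rule order_tendstoD(1)[OF tendsto_ident_at assms(2)])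
  have limF: "((\<lambda>u. free_gamma_F (Complex u y)) \<longlongrightarrow> free_gamma_F (Complex x y)) (at x)" if "0 < y" for y
    using isCont_free_gamma_F_Complex(2)[OF that, of x] by (simp add: isCont_def)
  fix a assume a: "a < free_gamma_v \<alpha> x"
  show "\<forall>\<^sub>F u in at x. a < free_gamma_v \<alpha> u"
  proof (cases "0 < a")
    case True
    have "1 / \<alpha> < free_gamma_F (Complex x a)"
      using free_gamma_F_vertical_strict[OF True a, of x] v(2) by simp
    from order_tendstoD(1)[OF limF[OF True] this] dom show ?thesis
    proof eventually_elim
      case (elim u)
      show ?case
        using free_gamma_F_vertical_strict[of "free_gamma_v \<alpha> u" a u] free_gamma_v[OF assms(1) elim(2)] elim(1)
        by (cases "free_gamma_v \<alpha> u" a rule: linorder_cases) auto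
    qed
  next
    case False
    show ?thesis using dom
      by eventually_elim (use False free_gamma_v(1)[OF assms(1)] in force)
  qed
next
  note v = free_gamma_v[OF assms]
  have dom: "\<forall>\<^sub>F u in at x. - free_gamma_c \<alpha> < u"
    by (rule order_tendstoD(1)[OF tendsto_ident_at assms(2)])
  fix a assume a: "free_gamma_v \<alpha> x < a"
  then have "0 < a" using v(1) by linarith
  then have "((\<lambda>u. free_gamma_F (Complex u a)) \<longlongrightarrow> free_gamma_F (Complex x a)) (at x)"
    using isCont_free_gamma_F_Complex(2)[of a x] by (simp add: isCont_def)
  moreover have "free_gamma_F (Complex x a) < 1 / \<alpha>"
    using free_gamma_F_vertical_strict[OF v(1) a, of x] v(2) by simp
  ultimately have "\<forall>\<^sub>F u in at x. free_gamma_F (Complex u a) < 1 / \<alpha>"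
    by (rule order_tendstoD(2))
  with dom show "\<forall>\<^sub>F u in at x. free_gamma_v \<alpha> u < a"
  proof eventually_elim
    case (elim u)
    show ?case
      using free_gamma_F_vertical_strict[of a "free_gamma_v \<alpha> u" u] free_gamma_v[OF assms(1) elim(1)] elim(2) \<open>0 < a\<close>
      by (cases "free_gamma_v \<alpha> u" a rule: linorder_cases) auto
  qed
qed

section \<open>\<open>P\<close> is close to the identity\<close>

lemma isCont_free_gamma_P:
  assumes "\<alpha> > 0" "- free_gamma_c \<alpha> < x"
  shows "isCont (free_gamma_P \<alpha>) x"
proof -
  have "isCont (\<lambda>x. Complex x (free_gamma_v \<alpha> x)) x"
    using isCont_free_gamma_v[OF assms] by (simp add: isCont_def tendsto_complex_iff)
  moreover have "isCont (free_gamma_H \<alpha>) (Complex x (free_gamma_v \<alpha> x))"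
    using free_gamma_v(1)[OF assms] by (intro isCont_free_gamma_H) (simp add: complex_nonneg_Reals_iff)
  ultimately have "isCont (\<lambda>x. free_gamma_H \<alpha> (Complex x (free_gamma_v \<alpha> x))) x"
    by (rule isCont_o2)
  then show ?thesis
    unfolding free_gamma_P_def by (rule isCont_Re)
qed

text \<open>
  With \<open>s = sqrt \<alpha>\<close>, the bound \<open>2 r \<le> 1 / s + s r\<^sup>2\<close> for \<open>r = 1 / \<bar>z - t\<bar>\<close> integrates to
  \<open>(1 / s + s F z) / 2 \<le> 1 / s\<close>, which the factor \<open>\<alpha>\<close> in \<open>H\<close> turns into \<open>s\<close>.
\<close>

lemma free_gamma_H_near_identity:
  assumes "\<alpha> > 0" "z \<notin> \<real>\<^sub>\<ge>\<^sub>0" "free_gamma_F z \<le> 1 / \<alpha>"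
  shows "cmod (free_gamma_H \<alpha> z - z - of_real \<alpha>) \<le> sqrt \<alpha>"
proof -
  define s where "s = sqrt \<alpha>"
  have s: "0 < s" "\<alpha> = s\<^sup>2" using assms(1) by (auto simp: s_def)
  have "cmod (\<integral>t. 1 / (z - of_real t) \<partial>gamma2) \<le> (\<integral>t. norm (1 / (z - of_real t)) \<partial>gamma2)"
    by (rule integral_norm_bound)
  also have "\<dots> \<le> (\<integral>t. 1 / (2 * s) + s / 2 * (1 / (cmod (z - of_real t))\<^sup>2) \<partial>gamma2)"
  proof (rule integral_mono_AE')
    show "integrable gamma2 (\<lambda>t. 1 / (2 * s) + s / 2 * (1 / (cmod (z - of_real t))\<^sup>2))"
      by (intro Bochner_Integration.integrable_add integrable_mult_right integrable_F assms) simp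
    have "norm (1 / (z - of_real t)) \<le> 1 / (2 * s) + s / 2 * (1 / (cmod (z - of_real t))\<^sup>2)" for t
    proof -
      define r where "r = 1 / cmod (z - of_real t)"
      have "0 \<le> (1 - s * r)\<^sup>2" by simp
      then have "r \<le> 1 / (2 * s) + s / 2 * r\<^sup>2"
        using s(1) by (simp add: field_simps power2_eq_square)
      then show ?thesis by (simp add: r_def norm_divide power_divide)
    qed
    then show "AE t in gamma2. norm (1 / (z - of_real t)) \<le> 1 / (2 * s) + s / 2 * (1 / (cmod (z - of_real t))\<^sup>2)"
      by simp
  qed (use s(1) in simp)
  also have "\<dots> = 1 / (2 * s) + s / 2 * free_gamma_F z"
    unfolding free_gamma_F_eq
    by (subst Bochner_Integration.integral_add)
       (use integrable_F[OF assms(2)] gamma2.prob_space in \<open>auto intro!: integrable_mult_right simp del: times_divide_eq_right\<close>)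
  also have "\<dots> \<le> 1 / (2 * s) + s / 2 * (1 / \<alpha>)"
    using assms(3) s(1) by (intro add_left_mono mult_left_mono) auto
  also have "\<dots> = 1 / s" using s by (simp add: field_simps power2_eq_square)
  finally have "cmod (\<integral>t. 1 / (z - of_real t) \<partial>gamma2) \<le> 1 / s" .
  then have "\<alpha> * cmod (\<integral>t. 1 / (z - of_real t) \<partial>gamma2) \<le> \<alpha> * (1 / s)"
    using assms(1) by (intro mult_left_mono) auto
  also have "\<alpha> * (1 / s) = s" using s by (simp add: power2_eq_square)
  finally show ?thesis using assms(1) by (simp add: free_gamma_H_eq norm_mult s_def)
qed

text \<open>
  On the graph of \<open>v\<close> the value of \<open>F\<close> is \<open>1 / \<alpha>\<close> to the right of \<open>- c\<close>, and at most \<open>F (- c) = 1 / \<alpha>\<close>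
  to the left of it, where \<open>v\<close> vanishes.
\<close>

lemma free_gamma_P_near_identity:
  assumes "\<alpha> > 0"
  shows "\<bar>free_gamma_P \<alpha> x - x - \<alpha>\<bar> \<le> sqrt \<alpha>"
proof -
  let ?z = "Complex x (free_gamma_v \<alpha> x)"
  note c = free_gamma_c[OF assms]
  have "?z \<notin> \<real>\<^sub>\<ge>\<^sub>0 \<and> free_gamma_F ?z \<le> 1 / \<alpha>"
  proof (cases "- free_gamma_c \<alpha> < x")
    case True
    then show ?thesis using free_gamma_v[OF assms True] by (simp add: complex_nonneg_Reals_iff)
  next
    case False
    then have z: "?z = of_real (- (- x))" by (simp add: free_gamma_v_def complex_eq_iff)
    have "free_gamma_F ?z \<le> free_gamma_F (of_real (- free_gamma_c \<alpha>))"
      unfolding z using free_gamma_F_negative_strict[of "free_gamma_c \<alpha>" "- x"] c(1) False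
      by (cases "x = - free_gamma_c \<alpha>") auto
    then show ?thesis using c False by (simp add: complex_nonneg_Reals_iff)
  qed
  then have "cmod (free_gamma_H \<alpha> ?z - ?z - of_real \<alpha>) \<le> sqrt \<alpha>"
    using free_gamma_H_near_identity assms by blast
  then show ?thesis
    using abs_Re_le_cmod[of "free_gamma_H \<alpha> ?z - ?z - of_real \<alpha>"] by (simp add: free_gamma_P_def)
qed

lemma free_gamma_P_surj_positive:
  assumes "\<alpha> > 0" "\<xi> > 0" "\<alpha> + sqrt \<alpha> \<le> \<xi> / 2"
  shows "\<xi> \<in> range (free_gamma_P \<alpha>)"
proof -
  have "free_gamma_P \<alpha> (\<xi> / 2) \<le> \<xi>" "\<xi> \<le> free_gamma_P \<alpha> (2 * \<xi>)"
    using free_gamma_P_near_identity[OF assms(1), of "\<xi> / 2"]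
      free_gamma_P_near_identity[OF assms(1), of "2 * \<xi>"] assms by linarith+
  moreover have "isCont (free_gamma_P \<alpha>) u" if "\<xi> / 2 \<le> u" for u
    using that assms(2) free_gamma_c(1)[OF assms(1)] by (intro isCont_free_gamma_P assms) linarith
  ultimately obtain u where "free_gamma_P \<alpha> u = \<xi>"
    using IVT[of "free_gamma_P \<alpha>" "\<xi> / 2" \<xi> "2 * \<xi>"] assms(2) by auto
  then show ?thesis by blast
qed

section \<open>The limit of the density\<close>

theorem proposition6p3:
  fixes x :: real
  assumes "x > 0"
  shows "((\<lambda>\<alpha>. 1 / \<alpha> * free_gamma_density \<alpha> x) \<longlongrightarrow> inverse x * exp (- x)) (at_right 0)"
proof -
  define X where "X \<alpha> = inv (free_gamma_P \<alpha>) x" for \<alpha>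
  define V where "V \<alpha> = free_gamma_v \<alpha> (X \<alpha>)" for \<alpha>
  have sqrt_lim: "((\<lambda>\<alpha>. sqrt \<alpha>) \<longlongrightarrow> 0) (at_right 0)"
    using tendsto_real_sqrt[of "\<lambda>\<alpha>. \<alpha>" 0 "at_right 0"] by simp
  have err_lim: "((\<lambda>\<alpha>. \<alpha> + sqrt \<alpha>) \<longlongrightarrow> 0) (at_right 0)"
    using tendsto_add[OF _ sqrt_lim, of "\<lambda>\<alpha>. \<alpha>" 0] by simp
  have pos: "\<forall>\<^sub>F \<alpha>::real in at_right 0. 0 < \<alpha>"
    by (rule eventually_at_right_less)
  have small: "\<forall>\<^sub>F \<alpha> in at_right 0. \<alpha> + sqrt \<alpha> < x / 2"
    by (rule order_tendstoD(2)[OF err_lim]) (use assms in simp)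
  \<comment> \<open>An inverse image at a point of the range is some preimage; the estimate on \<open>P\<close> applies to any.\<close>
  have facts: "\<forall>\<^sub>F \<alpha> in at_right 0. 0 < \<alpha> \<and> free_gamma_s \<alpha> < x \<and> \<bar>X \<alpha> - x\<bar> \<le> \<alpha> + sqrt \<alpha> \<and>
     0 < V \<alpha> \<and> V \<alpha> \<le> sqrt \<alpha> \<and> free_gamma_F (Complex (X \<alpha>) (V \<alpha>)) = 1 / \<alpha>"
    using pos small
  proof eventually_elim
    case (elim \<alpha>)
    have PX: "free_gamma_P \<alpha> (X \<alpha>) = x"
      unfolding X_def using elim assms by (intro f_inv_into_f free_gamma_P_surj_positive) auto
    have close: "\<bar>X \<alpha> - x\<bar> \<le> \<alpha> + sqrt \<alpha>"
      using free_gamma_P_near_identity[OF elim(1), of "X \<alpha>"] elim(1) PX by linarith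
    have c: "0 < free_gamma_c \<alpha>" by (rule free_gamma_c(1)[OF elim(1)])
    have dom: "- free_gamma_c \<alpha> < X \<alpha>" using close elim(2) c assms by linarith
    have "free_gamma_s \<alpha> < x"
      using free_gamma_P_near_identity[OF elim(1), of "- free_gamma_c \<alpha>"] elim(2) c assms
      unfolding free_gamma_s_def by linarith
    with elim(1) close free_gamma_v[OF elim(1) dom] free_gamma_v_le[OF elim(1) dom]
    show ?case by (simp add: V_def)
  qed
  have "((\<lambda>\<alpha>. X \<alpha> - x) \<longlongrightarrow> 0) (at_right 0)"
    by (rule Lim_null_comparison[OF _ err_lim]) (use facts in eventually_elim, simp)
  then have X_lim: "(X \<longlongrightarrow> x) (at_right 0)"
    by (simp add: LIM_zero_iff)
  have V_lim: "(V \<longlongrightarrow> 0) (at_right 0)"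
    by (rule Lim_null_comparison[OF _ sqrt_lim]) (use facts in eventually_elim, simp)
  have "((\<lambda>\<alpha>. Complex (X \<alpha>) (V \<alpha>)) \<longlongrightarrow> of_real x) (at_right 0)"
    using X_lim V_lim by (simp add: tendsto_complex_iff)
  moreover have "\<forall>\<^sub>F \<alpha> in at_right 0. Complex (X \<alpha>) (V \<alpha>) \<in> {z. 0 < Im z} \<and> Complex (X \<alpha>) (V \<alpha>) \<noteq> of_real x"
    using facts by eventually_elim (auto simp: complex_eq_iff)
  ultimately have "filterlim (\<lambda>\<alpha>. Complex (X \<alpha>) (V \<alpha>)) (at (of_real x) within {z. 0 < Im z}) (at_right 0)"
    by (simp add: filterlim_at)
  from filterlim_compose[OF poisson_boundary_limit this]
  have poisson: "((\<lambda>\<alpha>. V \<alpha> * free_gamma_F (Complex (X \<alpha>) (V \<alpha>))) \<longlongrightarrow> pi * erlang_density (Suc 0) 1 x) (at_right 0)"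
    by simp
  have "((\<lambda>\<alpha>. 1 / pi * (V \<alpha> * free_gamma_F (Complex (X \<alpha>) (V \<alpha>)) / ((X \<alpha>)\<^sup>2 + (V \<alpha>)\<^sup>2)))
      \<longlongrightarrow> 1 / pi * (pi * erlang_density (Suc 0) 1 x / (x\<^sup>2 + 0\<^sup>2))) (at_right 0)"
    using assms
    by (intro tendsto_mult_left tendsto_divide tendsto_add tendsto_power poisson X_lim V_lim) simp
  moreover have "\<forall>\<^sub>F \<alpha> in at_right 0. 1 / pi * (V \<alpha> * free_gamma_F (Complex (X \<alpha>) (V \<alpha>)) / ((X \<alpha>)\<^sup>2 + (V \<alpha>)\<^sup>2))
      = 1 / \<alpha> * free_gamma_density \<alpha> x"
    using facts
    by eventually_elim (simp add: free_gamma_density_def free_gamma_Q_def X_def V_def)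
  ultimately have "((\<lambda>\<alpha>. 1 / \<alpha> * free_gamma_density \<alpha> x)
      \<longlongrightarrow> 1 / pi * (pi * erlang_density (Suc 0) 1 x / (x\<^sup>2 + 0\<^sup>2))) (at_right 0)"
    by (rule Lim_transform_eventually)
  moreover have "1 / pi * (pi * erlang_density (Suc 0) 1 x / (x\<^sup>2 + 0\<^sup>2)) = inverse x * exp (- x)"
    using assms by (simp add: erlang_density_def power2_eq_square field_simps)
  ultimately show ?thesis by simp
qed

end
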